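(* Let $G$ be a graph with $n\ge4$ vertices and $M=M[IAS(G)]$. Then $\kappa(M)<n$ if and only if some graph locally equivalent to $G$ has a vertex of degree $<\frac{n-1}{2}$.
   Context: A graph is a finite looped simple graph; neighbors are via non-loop edges only, $N_G(v)=\{w\neq v\mid vw\in E(G)\}$, and the degree of $v$ is $|N_G(v)|$. $A(G)$ is the $GF(2)$ adjacency matrix (diagonal entry 1 iff looped). $M[IAS(G)]$ is the binary matroid represented by $(I\;A(G)\;A(G)+I)$. For a matroid $M$ on $W$ with rank $r$, $\lambda(S)=r(S)+r(W-S)-r(M)$; $S$ is a vertical $k$-separation if $\lambda(S)<k$ and $r(S),r(W-S)\ge k$; $\kappa(M)=\min(\{k\mid M\text{ has a vertical }k\text{-separation}\}\cup\{r(M)\})$. Local equivalence: the loop complement at $v$ reverses the loop status of $v$; the simple local complement at $v$ reverses all adjacencies between distinct elements of $N_G(v)$; the non-simple local complement at $v$ additionally reverses loop status at every vertex of $N_G(v)$. Graphs (on the same vertex set) are locally equivalent if one is obtained from the other by a sequence of these operations. *)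

theory Defs
  imports "HOL-Analysis.Analysis" "HOL-Library.Z2"
begin

section \<open>Looped simple graphs and local equivalence\<close>

text \<open>
  A looped simple graph with vertex set \<^term>\<open>UNIV :: 'v set\<close>, for a finite type \<^typ>\<open>'v\<close>, is a
  symmetric relation \<open>G\<close> on \<^typ>\<open>'v\<close>; the vertex \<open>v\<close> is looped iff \<open>G v v\<close>.
\<close>

type_synonym 'v lgraph = "'v \<Rightarrow> 'v \<Rightarrow> bool"

definition nbhd :: "'v lgraph \<Rightarrow> 'v \<Rightarrow> 'v set" where
  "nbhd G v = {w. w \<noteq> v \<and> G v w}"

definition vertex_degree :: "'v lgraph \<Rightarrow> 'v \<Rightarrow> nat" where
  "vertex_degree G v = card (nbhd G v)"

definition loop_complement :: "'v lgraph \<Rightarrow> 'v \<Rightarrow> 'v lgraph" where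
  "loop_complement G v = (\<lambda>x y. if x = v \<and> y = v then \<not> G x y else G x y)"

definition simple_local_complement :: "'v lgraph \<Rightarrow> 'v \<Rightarrow> 'v lgraph" where
  "simple_local_complement G v =
     (\<lambda>x y. if x \<in> nbhd G v \<and> y \<in> nbhd G v \<and> x \<noteq> y then \<not> G x y else G x y)"

text \<open>The case \<open>x = y\<close> is what reverses the loop status of the neighbors of \<open>v\<close>.\<close>

definition nonsimple_local_complement :: "'v lgraph \<Rightarrow> 'v \<Rightarrow> 'v lgraph" where
  "nonsimple_local_complement G v =
     (\<lambda>x y. if x \<in> nbhd G v \<and> y \<in> nbhd G v then \<not> G x y else G x y)"

inductive local_step :: "'v lgraph \<Rightarrow> 'v lgraph \<Rightarrow> bool" where
  "local_step G (loop_complement G v)"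
| "local_step G (simple_local_complement G v)"
| "local_step G (nonsimple_local_complement G v)"

definition locally_equivalent :: "'v lgraph \<Rightarrow> 'v lgraph \<Rightarrow> bool" where
  "locally_equivalent = local_step\<^sup>*\<^sup>*"

lemma symp_local_step: "local_step G H \<Longrightarrow> symp G \<Longrightarrow> symp H"
  by (erule local_step.cases)
    (auto simp: symp_def loop_complement_def simple_local_complement_def
       nonsimple_local_complement_def)

lemma symp_locally_equivalent: "locally_equivalent G H \<Longrightarrow> symp G \<Longrightarrow> symp H"
  unfolding locally_equivalent_def
  by (induction rule: rtranclp_induct) (auto intro: symp_local_step)


section \<open>Matroids and vertical connectivity\<close>

text \<open>
  The record carries no axioms; the matroids used below are represented by matrices and satisfy
  the independence axioms and the usual rank formula (\<open>is_matroid_binary_matroid\<close>,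
  \<open>mrank_binary_matroid\<close>).
\<close>

record 'e matroid =
  ground :: "'e set"
  indep :: "'e set \<Rightarrow> bool"

definition is_matroid :: "'e matroid \<Rightarrow> bool" where
  "is_matroid M \<longleftrightarrow>
     finite (ground M) \<and> (\<forall>X. indep M X \<longrightarrow> X \<subseteq> ground M) \<and> indep M {} \<and>
     (\<forall>X Y. indep M Y \<and> X \<subseteq> Y \<longrightarrow> indep M X) \<and>
     (\<forall>X Y. indep M X \<and> indep M Y \<and> card X < card Y \<longrightarrow> (\<exists>y\<in>Y - X. indep M (insert y X)))"

definition mrank :: "'e matroid \<Rightarrow> 'e set \<Rightarrow> nat" where
  "mrank M S = Max (card ` {X. X \<subseteq> S \<and> indep M X})"

definition connectivity :: "'e matroid \<Rightarrow> 'e set \<Rightarrow> int" where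
  "connectivity M S =
     int (mrank M S) + int (mrank M (ground M - S)) - int (mrank M (ground M))"

definition vertical_separation :: "'e matroid \<Rightarrow> nat \<Rightarrow> 'e set \<Rightarrow> bool" where
  "vertical_separation M k S \<longleftrightarrow>
     S \<subseteq> ground M \<and> connectivity M S < int k \<and>
     mrank M S \<ge> k \<and> mrank M (ground M - S) \<ge> k"

definition vertical_connectivity :: "'e matroid \<Rightarrow> nat" where
  "vertical_connectivity M =
     Inf ({k. \<exists>S. vertical_separation M k S} \<union> {mrank M (ground M)})"


section \<open>The isotropic matroid of a graph\<close>

text \<open>
  The matroid elements are the column indices, so equal columns at different indices are
  distinct (parallel) elements; hence the injectivity condition.
\<close>

definition binary_matroid :: "bit^'c^'r \<Rightarrow> 'c matroid" where
  "binary_matroid B =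
     \<lparr>ground = UNIV,
      indep = (\<lambda>X. inj_on (\<lambda>j. column j B) X \<and> vec.independent ((\<lambda>j. column j B) ` X))\<rparr>"

definition adjacency_matrix :: "('v::finite) lgraph \<Rightarrow> bit^'v^'v" where
  "adjacency_matrix G = (\<chi> v w. if G v w then 1 else 0)"

definition IAS :: "('v::finite) lgraph \<Rightarrow> bit^('v + 'v + 'v)^'v" where
  "IAS G = (\<chi> v c. case c of
       Inl w \<Rightarrow> (mat 1 :: bit^'v^'v) $ v $ w
     | Inr (Inl w) \<Rightarrow> adjacency_matrix G $ v $ w
     | Inr (Inr w) \<Rightarrow> (adjacency_matrix G + mat 1) $ v $ w)"

definition isotropic_matroid :: "('v::finite) lgraph \<Rightarrow> ('v + 'v + 'v) matroid" where
  "isotropic_matroid G = binary_matroid (IAS G)"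

lemma is_matroid_binary_matroid: "is_matroid (binary_matroid (B :: bit^'c::finite^'r::finite))"
proof -
  let ?f = "\<lambda>j. column j B"
  have exch: "\<exists>y\<in>Y - X. inj_on ?f (insert y X) \<and> vec.independent (?f ` insert y X)"
    if X: "inj_on ?f X" "vec.independent (?f ` X)"
      and Y: "inj_on ?f Y" "vec.independent (?f ` Y)" and less: "card X < card Y" for X Y
  proof -
    have "\<not> ?f ` Y \<subseteq> vec.span (?f ` X)"
    proof
      assume "?f ` Y \<subseteq> vec.span (?f ` X)"
      then have "card (?f ` Y) \<le> card (?f ` X)"
        using vec.independent_span_bound[of "?f ` X" "?f ` Y"] Y by auto
      then show False
        using less X Y by (simp add: card_image)
    qed
    then obtain y where y: "y \<in> Y" "?f y \<notin> vec.span (?f ` X)" by auto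
    have fy: "?f y \<notin> ?f ` X"
      using y(2) vec.span_base by metis
    then have "y \<in> Y - X" using y by blast
    moreover have "inj_on ?f (insert y X)"
      using X fy by (subst inj_on_insert) blast
    moreover have "vec.independent (?f ` insert y X)"
      unfolding image_insert using X y by (intro vec.independent_insertI) auto
    ultimately show ?thesis by blast
  qed
  have down: "inj_on ?f X \<and> vec.independent (?f ` X)"
    if "inj_on ?f Y" "vec.independent (?f ` Y)" "X \<subseteq> Y" for X Y
    using that by (meson inj_on_subset vec.independent_mono image_mono)
  show ?thesis
    unfolding is_matroid_def binary_matroid_def matroid.simps
  proof (intro conjI allI impI; (elim conjE)?)
    fix X Y
    assume "inj_on ?f Y" "vec.independent (?f ` Y)" "X \<subseteq> Y"
    then show "inj_on ?f X" "vec.independent (?f ` X)"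
      using down[of Y X] by simp_all
  next
    fix X Y
    assume "inj_on ?f X" "vec.independent (?f ` X)"
      "inj_on ?f Y" "vec.independent (?f ` Y)" "card X < card Y"
    then show "\<exists>y\<in>Y - X. inj_on ?f (insert y X) \<and> vec.independent (?f ` insert y X)"
      by (rule exch)
  qed (simp_all add: vec.independent_empty)
qed

lemma mrank_binary_matroid:
  fixes B :: "bit^'c::finite^'r::finite"
  shows "mrank (binary_matroid B) S = vec.dim ((\<lambda>j. column j B) ` S)"
proof -
  let ?f = "\<lambda>j. column j B"
  obtain C where C: "C \<subseteq> ?f ` S" "vec.independent C" "?f ` S \<subseteq> vec.span C"
    "card C = vec.dim (?f ` S)"
    using vec.basis_exists by metis
  obtain X where X: "X \<subseteq> S" "inj_on ?f X" "?f ` X = C"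
    using C(1) subset_image_inj by metis
  have "card X = vec.dim (?f ` S)"
    using X C(4) card_image by metis
  moreover have "card Y \<le> vec.dim (?f ` S)"
    if "Y \<subseteq> S" "inj_on ?f Y" "vec.independent (?f ` Y)" for Y
  proof -
    have "card Y = card (?f ` Y)" using that by (simp add: card_image)
    also have "\<dots> \<le> vec.dim (?f ` S)"
      using that by (intro vec.independent_card_le_dim) auto
    finally show ?thesis .
  qed
  ultimately show ?thesis
    unfolding mrank_def binary_matroid_def matroid.simps using X C(2)
    by (intro Max_eqI) (simp, blast, (rule image_eqI[of _ _ X]; simp))
qed

end

theory Submission
  imports Defs
begin

text \<open>
  The matroid has a vertical \<open>k\<close>-separation with \<open>k < n\<close> iff its ground set splits into two
  nonspanning parts, i.e. iff two nonzero vectors in the row space of \<open>(I A A+I)\<close> have disjoint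
  supports. At each vertex a row space vector has either no or exactly two nonzero entries among
  the three columns, so only the sets of vertices where the vectors are nonzero matter, and a local
  complementation preserves these sets. If two of them are disjoint, one has size
  at most \<open>n/2\<close>, and local complementations reduce the number of rows summed up until the closed
  neighborhood of some vertex is contained in that set. Conversely, if the closed neighborhood \<open>T\<close>
  of \<open>v\<close> has size at most \<open>n/2\<close>, then pigeonhole gives a nonzero sum of rows outside \<open>T\<close> that
  vanishes on \<open>T\<close>: there are at least \<open>|T|\<close> such rows but only \<open>|T| - 1\<close> conditions, the one at
  \<open>v\<close> being automatic.
\<close>

section \<open>Parity and annihilators\<close>

lemma odd_card_sym_diff:
  assumes "finite A" "finite B"
  shows "odd (card (sym_diff A B)) \<longleftrightarrow> odd (card A) \<noteq> odd (card B)"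
proof -
  have "card (sym_diff A B) = card (A - B) + card (B - A)"
    using assms by (intro card_Un_disjoint) auto
  moreover have "card A = card (A - B) + card (A \<inter> B)"
    using assms by (subst card_Un_disjoint[symmetric]) (auto intro!: arg_cong[where f = card])
  moreover have "card B = card (B - A) + card (A \<inter> B)"
    using assms by (subst card_Un_disjoint[symmetric]) (auto intro!: arg_cong[where f = card])
  ultimately show ?thesis by auto
qed

lemma odd_card_diff_singleton:
  assumes "finite A"
  shows "odd (card (A - {u})) \<longleftrightarrow> odd (card A) \<noteq> (u \<in> A)"
  using card_Suc_Diff1[OF assms, of u] by (cases "u \<in> A") (metis even_Suc, simp)

text \<open>A proper subspace lies in the kernel of a nonzero linear functional, and
  \<open>x\<close> is the coefficient vector of such a functional. Conversely, that kernel is a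
  proper subspace.\<close>

lemma vec_dim_less_iff_annihilated:
  fixes S :: "('a::field^'n) set"
  shows "vec.dim S < CARD('n) \<longleftrightarrow> (\<exists>x. x \<noteq> 0 \<and> (\<forall>s\<in>S. (\<Sum>i\<in>UNIV. x $ i * s $ i) = 0))"
proof
  assume less: "vec.dim S < CARD('n)"
  obtain C where C: "C \<subseteq> S" "vec.independent C" "S \<subseteq> vec.span C"
    using vec.basis_exists by metis
  have "vec.span C \<noteq> UNIV"
  proof
    assume "vec.span C = UNIV"
    then have "vec.dim C = CARD('n)"
      using vec.dim_span[of C] vec_dim_card[where 'a='a and 'n='n] by simp
    moreover have "vec.dim C \<le> vec.dim S" using C(1) by (intro vec.dim_subset)
    ultimately show False using less by simp
  qed
  then obtain b where b: "b \<notin> vec.span C" by blast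
  then have ind: "vec.independent (insert b C)" using C by (intro vec.independent_insertI)
  \<comment> \<open>Any coordinate \<open>k\<close> will do: \<open>g\<close> kills \<open>C\<close>
    and sends \<open>b\<close> to the unit vector at \<open>k\<close>, so row \<open>k\<close> of
    its matrix is the functional sought.\<close>
  obtain k :: 'n where True by simp
  obtain g where g: "Vector_Spaces.linear (*s) (*s) g"
    and gB: "\<forall>c\<in>insert b C. g c = (if c = b then axis k 1 else (0::'a^'n))"
    using vec.linear_independent_extend[OF ind, of "\<lambda>c. if c = b then axis k 1 else (0::'a^'n)"] by blast
  have "g s = 0" if "s \<in> vec.span C" for s
  proof (rule vec.linear_eq_0_on_span[OF g _ that])
    fix c assume "c \<in> C"
    then show "g c = 0" using gB b vec.span_base[of c C] by auto
  qed
  then have gS: "g s = 0" if "s \<in> S" for s using C that by blast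
  define x where "x = row k (matrix g)"
  have x: "(\<Sum>i\<in>UNIV. x $ i * s $ i) = g s $ k" for s
    using matrix_works[OF g, of s] by (auto simp: x_def row_def matrix_vector_mult_def vec_eq_iff)
  have "g b $ k = 1" using gB by simp
  then have "x \<noteq> 0" using x[of b] by auto
  then show "\<exists>x. x \<noteq> 0 \<and> (\<forall>s\<in>S. (\<Sum>i\<in>UNIV. x $ i * s $ i) = 0)"
    using x gS by auto
next
  assume "\<exists>x. x \<noteq> 0 \<and> (\<forall>s\<in>S. (\<Sum>i\<in>UNIV. x $ i * s $ i) = 0)"
  then obtain x where x: "x \<noteq> 0" "\<forall>s\<in>S. (\<Sum>i\<in>UNIV. x $ i * s $ i) = 0" by blast
  let ?K = "{s. (\<Sum>i\<in>UNIV. x $ i * s $ i) = 0}"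
  have "vec.subspace ?K"
    by (auto simp: vec.subspace_def algebra_simps sum.distrib sum_distrib_left[symmetric])
  then have sub: "vec.span S \<subseteq> ?K" using x by (intro vec.span_minimal) auto
  obtain k where k: "x $ k \<noteq> 0" using x by (auto simp: vec_eq_iff)
  have "(\<Sum>i\<in>UNIV. x $ i * axis k 1 $ i) = x $ k"
    by (simp add: axis_def if_distrib[where f = "\<lambda>z. _ * z"] cong: if_cong)
  then have "axis k 1 \<notin> ?K" using k by simp
  then have "vec.span S \<noteq> UNIV" using sub by blast
  then have "vec.span S \<subset> vec.span UNIV" by auto
  then have "vec.dim S < vec.dim (UNIV :: ('a^'n) set)" by (rule vec.dim_psubset)
  then show "vec.dim S < CARD('n)" by (simp only: vec_dim_card)
qed

section \<open>Row space and rank of the isotropic matroid\<close>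

text \<open>
  Linear combinations of the rows of \<^term>\<open>IAS G\<close> are indexed by sets of vertices \<open>X\<close>;
  \<open>cocycle G X j\<close> says that the \<open>j\<close>-th entry of the sum of the rows in \<open>X\<close> is nonzero.
\<close>

definition cocycle :: "'v lgraph \<Rightarrow> 'v set \<Rightarrow> 'v + 'v + 'v \<Rightarrow> bool" where
  "cocycle G X j = (case j of
       Inl w \<Rightarrow> w \<in> X
     | Inr (Inl w) \<Rightarrow> odd (card {v \<in> X. G v w})
     | Inr (Inr w) \<Rightarrow> odd (card {v \<in> X. G v w}) \<noteq> (w \<in> X))"

lemma sum_column_IAS:
  "(\<Sum>i\<in>UNIV. (\<chi> i. of_bool (i \<in> X)) $ i * column j (IAS G) $ i) = (of_bool (cocycle G X j) :: bit)"
proof -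
  define x :: "bit^'a" where "x = (\<chi> i. of_bool (i \<in> X))"
  have odd: "(of_nat n :: bit) = of_bool (odd n)" for n
    by (induction n) auto
  have I: "(\<Sum>i\<in>UNIV. x $ i * (mat 1 :: bit^'a^'a) $ i $ w) = of_bool (w \<in> X)" for w
    by (simp add: mat_def x_def if_distrib[where f = "\<lambda>z. _ * z"]
        del: sum_of_bool_mult_eq cong: if_cong)
  have "(\<Sum>i\<in>UNIV. x $ i * adjacency_matrix G $ i $ w) = (\<Sum>i\<in>{v \<in> X. G v w}. 1)" for w
    by (intro sum.mono_neutral_cong_right) (auto simp: adjacency_matrix_def x_def)
  then have A: "(\<Sum>i\<in>UNIV. x $ i * adjacency_matrix G $ i $ w)
      = of_bool (odd (card {v \<in> X. G v w}))" for w
    by (simp add: odd)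
  have "(\<Sum>i\<in>UNIV. x $ i * column j (IAS G) $ i) = of_bool (cocycle G X j)"
  proof -
    consider w where "j = Inl w" | w where "j = Inr (Inl w)" | w where "j = Inr (Inr w)"
      by (metis sum.exhaust)
    then show ?thesis
    proof cases
      case 1
      then show ?thesis
        by (simp only: cocycle_def column_def IAS_def vec_lambda_beta sum.case I)
    next
      case 2
      then show ?thesis
        by (simp only: cocycle_def column_def IAS_def vec_lambda_beta sum.case A)
    next
      case 3
      then show ?thesis
        by (simp only: cocycle_def column_def IAS_def vec_lambda_beta sum.case
            vector_add_component distrib_left sum.distrib A I) auto
    qed
  qed
  then show ?thesis unfolding x_def .
qed

text \<open>Every vector over GF(2) is the indicator of a set \<open>X\<close>, so an annihilator of
  the columns in \<open>S\<close> is a nonempty set of rows whose sum vanishes on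
  \<open>S\<close>.\<close>

lemma mrank_isotropic_less_iff:
  fixes G :: "('v::finite) lgraph"
  shows "mrank (isotropic_matroid G) S < CARD('v) \<longleftrightarrow> (\<exists>X. X \<noteq> {} \<and> (\<forall>j\<in>S. \<not> cocycle G X j))"
proof -
  define x :: "'v set \<Rightarrow> bit^'v" where "x X = (\<chi> i. of_bool (i \<in> X))" for X
  have zero: "x X = 0 \<longleftrightarrow> X = {}" for X
    unfolding x_def vec_eq_iff vec_lambda_beta zero_index of_bool_eq_0_iff by blast
  have orth: "(\<Sum>i\<in>UNIV. x X $ i * column j (IAS G) $ i) = 0 \<longleftrightarrow> \<not> cocycle G X j" for X j
    unfolding x_def sum_column_IAS of_bool_eq_0_iff ..
  have "y = x {i. y $ i = 1}" for y
    by (auto simp: x_def vec_eq_iff of_bool_def)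
  then have "surj x" by (rule surjI[OF sym])
  then have ex: "(\<exists>y. P y) \<longleftrightarrow> (\<exists>X. P (x X))" for P
    by (metis surjD)
  have "mrank (isotropic_matroid G) S < CARD('v) \<longleftrightarrow>
      (\<exists>y. y \<noteq> 0 \<and> (\<forall>j\<in>S. (\<Sum>i\<in>UNIV. y $ i * column j (IAS G) $ i) = 0))"
    by (simp add: isotropic_matroid_def mrank_binary_matroid vec_dim_less_iff_annihilated)
  also have "\<dots> \<longleftrightarrow> (\<exists>X. x X \<noteq> 0 \<and> (\<forall>j\<in>S. (\<Sum>i\<in>UNIV. x X $ i * column j (IAS G) $ i) = 0))"
    by (rule ex)
  finally show ?thesis by (simp only: zero orth)
qed

lemma mrank_isotropic_ground:
  fixes G :: "('v::finite) lgraph"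
  shows "mrank (isotropic_matroid G) (ground (isotropic_matroid G)) = CARD('v)"
proof -
  have "\<not> mrank (isotropic_matroid G) UNIV < CARD('v)"
    unfolding mrank_isotropic_less_iff
  proof safe
    fix X :: "'v set" and x
    assume "\<forall>j\<in>UNIV. \<not> cocycle G X j" "x \<in> X"
    then have "\<not> cocycle G X (Inl x)" by blast
    then show "x \<in> {}" using \<open>x \<in> X\<close> by (simp add: cocycle_def)
  qed
  moreover have "mrank (isotropic_matroid G) UNIV \<le> CARD('v)"
    unfolding isotropic_matroid_def mrank_binary_matroid
    using vec.dim_subset[OF subset_UNIV] vec_dim_card[where 'a=bit and 'n='v] by metis
  ultimately show ?thesis by (simp add: isotropic_matroid_def binary_matroid_def)
qed

section \<open>Vertical separations as disjoint cosupports\<close>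

text \<open>
  The set of vertices at which the sum of the rows in \<open>X\<close> has a nonzero entry in one of the
  three columns; it does not depend on loops.
\<close>

definition cosupport :: "'v lgraph \<Rightarrow> 'v set \<Rightarrow> 'v set" where
  "cosupport G X = X \<union> {v. odd (card (nbhd G v \<inter> X))}"

lemma cosupport_iff_cocycle:
  assumes "symp G"
  shows "w \<in> cosupport G X \<longleftrightarrow> cocycle G X (Inl w) \<or> cocycle G X (Inr (Inl w))"
proof (cases "w \<in> X")
  case False
  have "nbhd G w \<inter> X = {v \<in> X. G v w}"
    using assms False by (auto simp: nbhd_def symp_def)
  then show ?thesis by (simp add: cosupport_def cocycle_def)
qed (simp add: cosupport_def cocycle_def)

text \<open>The three columns at \<open>w\<close> sum to zero, so a row space vector that is nonzero
  at \<open>w\<close> is nonzero in exactly two of them.\<close>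

lemma cocycle_third: "cocycle G X (Inr (Inr w)) \<longleftrightarrow> cocycle G X (Inl w) \<noteq> cocycle G X (Inr (Inl w))"
  by (auto simp: cocycle_def)

definition separated :: "'v lgraph \<Rightarrow> bool" where
  "separated G \<longleftrightarrow> (\<exists>X Y. X \<noteq> {} \<and> Y \<noteq> {} \<and> cosupport G X \<inter> cosupport G Y = {})"

lemma vertical_connectivity_less_iff_separated:
  fixes G :: "('v::finite) lgraph"
  assumes "symp G"
  shows "vertical_connectivity (isotropic_matroid G) < CARD('v) \<longleftrightarrow> separated G"
proof -
  let ?M = "isotropic_matroid G" and ?n = "CARD('v)"
  have ground: "ground ?M = UNIV" by (simp add: isotropic_matroid_def binary_matroid_def)
  have rM: "mrank ?M UNIV = ?n" using mrank_isotropic_ground[of G] ground by simp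
  have "vertical_connectivity ?M < ?n \<longleftrightarrow> (\<exists>k S. k < ?n \<and> vertical_separation ?M k S)"
    unfolding vertical_connectivity_def ground rM by (subst cInf_less_iff) auto
  also have "\<dots> \<longleftrightarrow> (\<exists>S. mrank ?M S < ?n \<and> mrank ?M (- S) < ?n)"
  proof
    \<comment> \<open>From r(S) + r(-S) < n + k and r(-S) \<ge> k follows r(S) < n, and
      symmetrically for -S.\<close>
    assume "\<exists>k S. k < ?n \<and> vertical_separation ?M k S"
    then show "\<exists>S. mrank ?M S < ?n \<and> mrank ?M (- S) < ?n"
      unfolding vertical_separation_def connectivity_def ground rM Compl_eq_Diff_UNIV[symmetric]
      by (smt (verit) of_nat_le_iff of_nat_less_iff)
  next
    assume "\<exists>S. mrank ?M S < ?n \<and> mrank ?M (- S) < ?n"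
    then obtain S where S: "mrank ?M S < ?n" "mrank ?M (- S) < ?n" by blast
    \<comment> \<open>The least \<open>k\<close> exceeding the connectivity suffices: as r(-S) \<le>
      n - 1, it is at most r(S), and likewise at most r(-S).\<close>
    have "vertical_separation ?M (nat (connectivity ?M S + 1)) S"
        "nat (connectivity ?M S + 1) < ?n"
      using S unfolding vertical_separation_def connectivity_def ground rM Compl_eq_Diff_UNIV[symmetric]
      by auto
    then show "\<exists>k S. k < ?n \<and> vertical_separation ?M k S" by blast
  qed
  also have "\<dots> \<longleftrightarrow> separated G"
  proof
    assume "\<exists>S. mrank ?M S < ?n \<and> mrank ?M (- S) < ?n"
    then obtain S X Y where *: "X \<noteq> {}" "Y \<noteq> {}"
      "\<And>j. j \<in> S \<Longrightarrow> \<not> cocycle G X j" "\<And>j. j \<notin> S \<Longrightarrow> \<not> cocycle G Y j"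
      unfolding mrank_isotropic_less_iff by blast
    \<comment> \<open>Two vectors that are nonzero at \<open>w\<close> each occupy two of its three
      columns, so they share one.\<close>
    have "w \<notin> cosupport G X \<inter> cosupport G Y" for w
      using *(3,4)[of "Inl w"] *(3,4)[of "Inr (Inl w)"] *(3,4)[of "Inr (Inr w)"]
      unfolding Int_iff cosupport_iff_cocycle[OF assms] cocycle_third by blast
    then show "separated G" using * unfolding separated_def by blast
  next
    assume "separated G"
    then obtain X Y where *: "X \<noteq> {}" "Y \<noteq> {}" "cosupport G X \<inter> cosupport G Y = {}"
      unfolding separated_def by blast
    have "\<not> cocycle G X j \<or> \<not> cocycle G Y j" for j
    proof -
      obtain w where "j = Inl w \<or> j = Inr (Inl w) \<or> j = Inr (Inr w)" by (metis sum.exhaust)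
      moreover have "w \<notin> cosupport G X \<inter> cosupport G Y" using * by blast
      ultimately show ?thesis
        unfolding Int_iff cosupport_iff_cocycle[OF assms] using cocycle_third[of G _ w] by blast
    qed
    then show "\<exists>S. mrank ?M S < ?n \<and> mrank ?M (- S) < ?n"
      unfolding mrank_isotropic_less_iff using *
      by (intro exI[of _ "{j. \<not> cocycle G X j}"]) auto
  qed
  finally show ?thesis .
qed

section \<open>Invariance under local equivalence\<close>

lemma nbhd_sym: "symp G \<Longrightarrow> u \<in> nbhd G v \<longleftrightarrow> v \<in> nbhd G u"
  by (auto simp: nbhd_def symp_def)

lemma nbhd_loop_complement: "nbhd (loop_complement G v) = nbhd G"
  by (auto simp: fun_eq_iff nbhd_def loop_complement_def)

lemma nbhd_nonsimple_local_complement: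
  "nbhd (nonsimple_local_complement G v) = nbhd (simple_local_complement G v)"
  by (auto simp: fun_eq_iff nbhd_def simple_local_complement_def nonsimple_local_complement_def)

lemma nbhd_simple_local_complement:
  "nbhd (simple_local_complement G v) u =
    (if u \<in> nbhd G v then sym_diff (nbhd G u) (nbhd G v - {u}) else nbhd G u)"
  by (auto simp: nbhd_def simple_local_complement_def)

lemma nbhd_simple_local_complement_twice:
  "nbhd (simple_local_complement (simple_local_complement G v) v) = nbhd G"
proof
  fix u
  have "v \<notin> nbhd G v" by (simp add: nbhd_def)
  then show "nbhd (simple_local_complement (simple_local_complement G v) v) u = nbhd G u"
    by (auto simp: nbhd_simple_local_complement)
qed

text \<open>
  If \<open>X\<close> indexes a row space vector of \<open>G\<close>, then \<open>toggle G v X\<close> indexes the corresponding vector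
  after local complementation at \<open>v\<close>, which permutes the three columns belonging to each vertex.
\<close>

definition toggle :: "'v lgraph \<Rightarrow> 'v \<Rightarrow> 'v set \<Rightarrow> 'v set" where
  "toggle G v X = (if odd (card (nbhd G v \<inter> X)) then sym_diff X {v} else X)"

text \<open>Only \<open>X = {v}\<close> could become empty, but \<open>v\<close> has no neighbor in
  that set, so nothing is toggled.\<close>

lemma toggle_nonempty: "X \<noteq> {} \<Longrightarrow> toggle G v X \<noteq> {}"
proof
  assume X: "X \<noteq> {}" and *: "toggle G v X = {}"
  then have "X = {v}" "odd (card (nbhd G v \<inter> X))" by (auto simp: toggle_def split: if_splits)
  then show False by (auto simp: nbhd_def)
qed

text \<open>The critical case is a neighbor \<open>u\<close> of \<open>v\<close>: toggling
  \<open>v\<close> and complementing both shift the parity at \<open>u\<close> by \<open>?c\<close>,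
  and these shifts cancel. What remains is a flip when \<open>u\<close> is in \<open>X\<close>,
  where \<open>u\<close> is in the cosupport anyway.\<close>

lemma cosupport_local_complement:
  fixes G :: "('v::finite) lgraph"
  assumes "symp G"
  shows "cosupport (simple_local_complement G v) (toggle G v X) = cosupport G X"
proof (rule set_eqI)
  fix u
  let ?H = "simple_local_complement G v" and ?c = "odd (card (nbhd G v \<inter> X))"
  have v: "v \<notin> nbhd G v" by (simp add: nbhd_def)
  have vt: "nbhd G v \<inter> toggle G v X = nbhd G v \<inter> X" using v by (auto simp: toggle_def)
  consider "u = v" | "u \<noteq> v" "u \<notin> nbhd G v" | "u \<in> nbhd G v" by blast
  then show "u \<in> cosupport ?H (toggle G v X) \<longleftrightarrow> u \<in> cosupport G X"
  proof cases
    case 1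
    then show ?thesis
      using v vt by (auto simp: cosupport_def nbhd_simple_local_complement toggle_def)
  next
    case 2
    then have "v \<notin> nbhd G u" using nbhd_sym[OF assms] by metis
    then have "nbhd G u \<inter> toggle G v X = nbhd G u \<inter> X" by (auto simp: toggle_def)
    then show ?thesis
      using 2 by (auto simp: cosupport_def nbhd_simple_local_complement toggle_def)
  next
    case 3
    then have uv: "u \<noteq> v" "v \<in> nbhd G u" using v nbhd_sym[OF assms] by auto
    have "nbhd ?H u \<inter> toggle G v X =
        sym_diff (nbhd G u \<inter> toggle G v X) (nbhd G v \<inter> X - {u})"
      using 3 vt by (auto simp: nbhd_simple_local_complement)
    then have "odd (card (nbhd ?H u \<inter> toggle G v X)) \<longleftrightarrow>
        odd (card (nbhd G u \<inter> toggle G v X)) \<noteq> odd (card (nbhd G v \<inter> X - {u}))"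
      by (simp only: odd_card_sym_diff finite)
    also have "odd (card (nbhd G v \<inter> X - {u})) \<longleftrightarrow> ?c \<noteq> (u \<in> X)"
      using 3 by (subst odd_card_diff_singleton) auto
    also have "odd (card (nbhd G u \<inter> toggle G v X)) \<longleftrightarrow> odd (card (nbhd G u \<inter> X)) \<noteq> ?c"
    proof (cases ?c)
      case True
      then have "nbhd G u \<inter> toggle G v X = sym_diff (nbhd G u \<inter> X) {v}"
        using uv by (auto simp: toggle_def)
      then show ?thesis using True odd_card_sym_diff[of "nbhd G u \<inter> X" "{v}"] by simp
    qed (simp add: toggle_def)
    finally show ?thesis using uv by (auto simp: cosupport_def toggle_def)
  qed
qed

lemma separated_local_complement:
  fixes G :: "('v::finite) lgraph"
  assumes "symp G" "separated G"
  shows "separated (simple_local_complement G v)"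
  using assms unfolding separated_def
  by (metis toggle_nonempty cosupport_local_complement)

lemma separated_cong: "nbhd G = nbhd H \<Longrightarrow> separated G \<longleftrightarrow> separated H"
  by (simp add: separated_def cosupport_def)

lemma separated_locally_equivalent:
  fixes G :: "('v::finite) lgraph"
  assumes "symp G" "locally_equivalent G H"
  shows "separated G \<longleftrightarrow> separated H"
  using assms(2,1) unfolding locally_equivalent_def
proof (induction rule: rtranclp_induct)
  case (step H K)
  then have "symp H"
    using symp_locally_equivalent unfolding locally_equivalent_def by blast
  \<comment> \<open>Local complementation is an involution on neighborhoods, so the one-sided
    preservation yields an equivalence.\<close>
  then have slc: "separated H \<longleftrightarrow> separated (simple_local_complement H v)" for v
    using separated_local_complement nbhd_simple_local_complement_twice[of H v]
      separated_cong symp_local_step local_step.intros(2) by metis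
  have "separated H \<longleftrightarrow> separated K"
    using step(2)
  proof cases
    case (1 v)
    then show ?thesis using separated_cong[OF nbhd_loop_complement] by metis
  next
    case (2 v)
    then show ?thesis using slc by simp
  next
    case (3 v)
    then show ?thesis using slc separated_cong[OF nbhd_nonsimple_local_complement] by metis
  qed
  with step show ?case by blast
qed simp

section \<open>Low degrees and disjoint cosupports\<close>

lemma locally_equivalent_low_degree:
  fixes G :: "('v::finite) lgraph"
  assumes "symp G" "X \<noteq> {}"
  shows "\<exists>H v. locally_equivalent G H \<and> vertex_degree H v < card (cosupport G X)"
  using assms
proof (induction "card X" arbitrary: G X rule: less_induct)
  case less
  let ?L = simple_local_complement
  note symp = less.prems(1)
  have fin: "finite A" for A :: "'v set" by simp
  have step: "local_step G' (?L G' v)" for G' :: "'v lgraph" and v by (rule local_step.intros)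
  have symL: "symp (?L G v)" for v using symp_local_step[OF step symp] .
  have irr: "v \<notin> nbhd G v" for v by (simp add: nbhd_def)
  \<comment> \<open>A vertex of \<open>X\<close> with oddly many neighbors in \<open>X\<close> is
    toggled out of \<open>X\<close> by complementing there, while the cosupport stays fixed.\<close>
  have reduce: ?case
    if G': "symp G'" "locally_equivalent G G'" "cosupport G' X = cosupport G X"
      and v: "v \<in> X" "odd (card (nbhd G' v \<inter> X))" for G' v
  proof -
    have t: "toggle G' v X = X - {v}" using v by (auto simp: toggle_def)
    have "card (X - {v}) < card X" using v by (intro card_Diff1_less) auto
    moreover have "X - {v} \<noteq> {}" using toggle_nonempty[OF less.prems(2), of G' v] t by simp
    moreover have "symp (?L G' v)" using symp_local_step[OF step G'(1)] .
    ultimately obtain H u where "locally_equivalent (?L G' v) H"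
      "vertex_degree H u < card (cosupport (?L G' v) (X - {v}))"
      using less.hyps by blast
    moreover have "cosupport (?L G' v) (X - {v}) = cosupport G X"
      using cosupport_local_complement[OF G'(1), of v X] t G'(3) by simp
    moreover have "locally_equivalent G (?L G' v)"
      using G'(2) step[of G' v] unfolding locally_equivalent_def by simp
    ultimately show ?thesis
      unfolding locally_equivalent_def by (metis rtranclp_trans)
  qed
  have le1: "locally_equivalent G (?L G v)" for v
    using step[of G v] unfolding locally_equivalent_def by blast
  \<comment> \<open>Complementing at \<open>t\<close> leaves \<open>X\<close> alone but makes the number of neighbors of \<open>u\<close> in \<open>X\<close> odd.\<close>
  have even_case: ?case if t: "even (card (nbhd G t \<inter> X))" "u \<in> nbhd G t" "u \<in> X"
    "even (card (nbhd G u \<inter> X))" for t u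
  proof (rule reduce[of "?L G t" u])
    show "cosupport (?L G t) X = cosupport G X"
      using cosupport_local_complement[OF symp, of t X] t(1) by (simp add: toggle_def)
    have "nbhd (?L G t) u \<inter> X = sym_diff (nbhd G u \<inter> X) (nbhd G t \<inter> X - {u})"
      using t(2) by (auto simp: nbhd_simple_local_complement)
    then have "odd (card (nbhd (?L G t) u \<inter> X)) \<longleftrightarrow>
        odd (card (nbhd G u \<inter> X)) \<noteq> odd (card (nbhd G t \<inter> X - {u}))"
      by (simp only: odd_card_sym_diff fin)
    moreover have "odd (card (nbhd G t \<inter> X - {u}))"
      using t by (subst odd_card_diff_singleton) auto
    ultimately show "odd (card (nbhd (?L G t) u \<inter> X))" using t by simp
  qed (use symL le1 t in auto)
  have refl: "locally_equivalent G G" unfolding locally_equivalent_def by simp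
  show ?case
  proof (cases "(\<exists>v\<in>X. odd (card (nbhd G v \<inter> X))) \<or>
      (\<exists>t. even (card (nbhd G t \<inter> X)) \<and> nbhd G t \<inter> X \<noteq> {})")
    case True
    then show ?thesis using reduce[OF symp refl] even_case by blast
  next
    case False
    obtain u where u: "u \<in> X" using less.prems by blast
    \<comment> \<open>No reduction applies, so every vertex with a neighbor in \<open>X\<close> has
      oddly many and thus lies in the cosupport.\<close>
    have "insert u (nbhd G u) \<subseteq> cosupport G X"
    proof
      fix w assume w: "w \<in> insert u (nbhd G u)"
      show "w \<in> cosupport G X"
      proof (cases "w = u")
        case False
        then have "u \<in> nbhd G w \<inter> X" using w u nbhd_sym[OF symp] by blast
        then have "odd (card (nbhd G w \<inter> X))" using \<open>\<not> (_ \<or> _)\<close> by blast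
        then show ?thesis by (simp add: cosupport_def)
      qed (simp add: cosupport_def u)
    qed
    then have "card (insert u (nbhd G u)) \<le> card (cosupport G X)"
      by (intro card_mono) auto
    then have "vertex_degree G u < card (cosupport G X)"
      using irr by (simp add: vertex_degree_def)
    then show ?thesis using refl by blast
  qed
qed

lemma separated_if_low_degree:
  fixes G :: "('v::finite) lgraph"
  assumes "symp G" and deg: "2 * (vertex_degree G v + 1) \<le> CARD('v)"
  shows "separated G"
proof -
  define T where "T = insert v (nbhd G v)"
  have irr: "v \<notin> nbhd G v" by (simp add: nbhd_def)
  have cT: "card T = vertex_degree G v + 1" using irr by (simp add: T_def vertex_degree_def)
  have "card (- T) = CARD('v) - card T" unfolding Compl_eq_Diff_UNIV by (intro card_Diff_subset) auto
  then have "card (nbhd G v) < card (- T)"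
    using deg cT by (simp add: vertex_degree_def)
  then have "card (Pow (nbhd G v)) < card (Pow (- T))" by (simp add: card_Pow)
  moreover define f where "f X = {w \<in> nbhd G v. odd (card (nbhd G w \<inter> X))}" for X
  then have "f ` Pow (- T) \<subseteq> Pow (nbhd G v)" by auto
  ultimately have "\<not> inj_on f (Pow (- T))"
    by (meson card_inj_on_le finite leD)
  \<comment> \<open>A collision replaces a kernel argument: \<open>f\<close> records parities, which
    add under symmetric difference, so those of \<open>sym_diff A B\<close> are all even.\<close>
  then obtain A B where AB: "A \<subseteq> - T" "B \<subseteq> - T" "f A = f B" "A \<noteq> B"
    by (auto simp: inj_on_def)
  define X where "X = sym_diff A B"
  have "even (card (nbhd G w \<inter> X))" if "w \<in> nbhd G v" for w
  proof -
    have "nbhd G w \<inter> X = sym_diff (nbhd G w \<inter> A) (nbhd G w \<inter> B)" by (auto simp: X_def)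
    moreover have "odd (card (nbhd G w \<inter> A)) \<longleftrightarrow> odd (card (nbhd G w \<inter> B))"
      using AB(3) that by (auto simp: f_def)
    ultimately show ?thesis
      using odd_card_sym_diff[of "nbhd G w \<inter> A" "nbhd G w \<inter> B"] by simp
  qed
  moreover have XT: "X \<inter> T = {}" using AB by (auto simp: X_def)
  moreover have "nbhd G v \<inter> X = {}" using XT by (auto simp: T_def)
  ultimately have "cosupport G X \<inter> T = {}" by (auto simp: cosupport_def T_def)
  \<comment> \<open>The row of \<open>v\<close> alone is the second vector; it lives on the closed
    neighborhood.\<close>
  moreover have "cosupport G {v} \<subseteq> T"
  proof
    fix w assume "w \<in> cosupport G {v}"
    then have "w = v \<or> v \<in> nbhd G w" by (cases "v \<in> nbhd G w") (auto simp: cosupport_def)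
    then show "w \<in> T" using nbhd_sym[OF assms(1)] by (auto simp: T_def)
  qed
  moreover have "X \<noteq> {}" using AB by (auto simp: X_def)
  ultimately show ?thesis unfolding separated_def by blast
qed

theorem theorem5:
  fixes G :: "('v::finite) lgraph"
  assumes "symp G"
    and "CARD('v) \<ge> 4"
  shows "vertical_connectivity (isotropic_matroid G) < CARD('v) \<longleftrightarrow>
    (\<exists>H v. locally_equivalent G H \<and> real (vertex_degree H v) < (real CARD('v) - 1) / 2)"
proof -
  \<comment> \<open>By integrality, the degree bound says that the closed neighborhood has at most
    half of the vertices.\<close>
  have deg: "real d < (real CARD('v) - 1) / 2 \<longleftrightarrow> 2 * (d + 1) \<le> CARD('v)" for d
    by (simp add: field_simps) linarith
  have "separated G \<longleftrightarrow> (\<exists>H v. locally_equivalent G H \<and> 2 * (vertex_degree H v + 1) \<le> CARD('v))"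
  proof
    assume "separated G"
    then obtain X Y where XY: "X \<noteq> {}" "Y \<noteq> {}" "cosupport G X \<inter> cosupport G Y = {}"
      unfolding separated_def by blast
    have "card (cosupport G X) + card (cosupport G Y) = card (cosupport G X \<union> cosupport G Y)"
      using XY by (simp add: card_Un_disjoint)
    also have "\<dots> \<le> CARD('v)" by (intro card_mono) auto
    finally have "2 * card (cosupport G X) \<le> CARD('v) \<or> 2 * card (cosupport G Y) \<le> CARD('v)"
      by linarith
    then obtain Z where "Z \<noteq> {}" "2 * card (cosupport G Z) \<le> CARD('v)" using XY by blast
    moreover from this obtain H v where "locally_equivalent G H"
        "vertex_degree H v < card (cosupport G Z)"
      using locally_equivalent_low_degree[OF assms(1)] by blast
    ultimately show "\<exists>H v. locally_equivalent G H \<and> 2 * (vertex_degree H v + 1) \<le> CARD('v)"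
      by (intro exI[of _ H] exI[of _ v]) simp
  next
    assume "\<exists>H v. locally_equivalent G H \<and> 2 * (vertex_degree H v + 1) \<le> CARD('v)"
    then obtain H v where H: "locally_equivalent G H" "2 * (vertex_degree H v + 1) \<le> CARD('v)"
      by blast
    then have "separated H"
      using separated_if_low_degree symp_locally_equivalent assms(1) by blast
    then show "separated G" using separated_locally_equivalent[OF assms(1) H(1)] by simp
  qed
  then show ?thesis
    unfolding vertical_connectivity_less_iff_separated[OF assms(1)] deg .
qed

end
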